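(* For every $q\in\mathbb{N}$, with $C:=C_p(q):=\left((1-p)^{-q-1}-1\right)^{-1}$, one has $$\mathbb{P}\left(\omega:\frac{z_{n+1}(\omega)}{Z_n(\omega)}>q\right)\sim\left(\frac{(C+1)^{C+1}}{C^{C}}\,p\,(1-p)^{(1+q)C+q}\right)^{n}\qquad (n\to\infty).$$
   Context: $\mathbb{N}=\{1,2,3,\dots\}$. Let $\omega=(\omega_i)_{i\in\mathbb{N}}$ be a Bernoulli process over the symbol space $\{1,\dots,r\}$ with probability vector $(p_1,\dots,p_r)$, i.e. under $\mathbb{P}$ the $\omega_i$ are i.i.d. with $\mathbb{P}(\omega_i=j)=p_j$. Fix a symbol $k\in\{1,\dots,r\}$ with $p:=p_k\in(0,1)$. Let $Z_0:=0$ and, for $n\ge1$, let $Z_n(\omega):=\inf\{\ell\in\mathbb{N}:\ell>Z_{n-1}(\omega),\ \omega_\ell=k\}$ and $z_n(\omega):=Z_n(\omega)-Z_{n-1}(\omega)$. For positive sequences, $a_n\sim b_n$ means $\lim_{n\to\infty}a_n/b_n=1$. *)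

theory Defs
  imports "HOL-Probability.Probability" "HOL-Library.Landau_Symbols"
begin

definition bernoulli_process ::
    "'a measure \<Rightarrow> nat \<Rightarrow> (nat \<Rightarrow> real) \<Rightarrow> (nat \<Rightarrow> 'a \<Rightarrow> nat) \<Rightarrow> bool" where
  "bernoulli_process M r p X \<longleftrightarrow>
     prob_space M \<and>
     (\<forall>j\<in>{1..r}. 0 \<le> p j) \<and> (\<Sum>j=1..r. p j) = 1 \<and>
     prob_space.indep_vars M (\<lambda>_. count_space {1..r}) X {1..} \<and>
     (\<forall>i\<ge>1. \<forall>j\<in>{1..r}. measure M {x \<in> space M. X i x = j} = p j)"

(* A sequence w is indexed by i >= 1; its entry w 0 is never used.
   Hitting times take values in enat, where the infimum of the empty set is infinity. *)
fun hit_time :: "nat \<Rightarrow> nat \<Rightarrow> (nat \<Rightarrow> nat) \<Rightarrow> enat" where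
  "hit_time k 0 w = 0"
| "hit_time k (Suc n) w =
     Inf (enat ` {l. 1 \<le> l \<and> hit_time k n w < enat l \<and> w l = k})"

(* Meaningful for n >= 1. On enat, infinity minus infinity is infinity; this occurs only
   when the symbol k appears fewer than n - 1 times in w. *)
definition gap_time :: "nat \<Rightarrow> nat \<Rightarrow> (nat \<Rightarrow> nat) \<Rightarrow> enat" where
  "gap_time k n w = hit_time k n w - hit_time k (n - 1) w"

definition C_const :: "real \<Rightarrow> nat \<Rightarrow> real" where
  "C_const p q = inverse ((1 - p) powr (- real q - 1) - 1)"

end

theory Submission
  imports Defs
begin

text \<open>
  For \<open>n \<ge> 1\<close> the two sequences coincide, so the asymptotic equivalence is really an equality.
  In probabilistic terms: \<open>Z\<^sub>n\<close> is a sum of \<open>n\<close> independent geometric variables and \<open>z\<^sub>n\<^sub>+\<^sub>1\<close> is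
  a further one, independent of it, so the probability is the expectation of
  \<open>(1 - p) ^ (q Z\<^sub>n)\<close>, the probability generating function of \<open>Z\<^sub>n\<close> at \<open>(1 - p) ^ q\<close>. With
  \<open>s = (1 - p) ^ (q + 1)\<close> this is \<open>(p (1 - p) ^ q / (1 - s)) ^ n\<close> (lemma \<open>prob_gap_ratio\<close>). Since
  \<open>C = s / (1 - s)\<close> and \<open>C + 1 = 1 / (1 - s)\<close>, the base given in terms of \<open>C\<close> is the same
  number (lemma \<open>rate_eq\<close>).

  The proof does not construct the law of the gaps, but counts. The relation
  \<open>Z\<^sub>n \<le> m\<close> says that at least \<open>n\<close> hits occur up to time \<open>m\<close> (lemma \<open>hit_time_le_iff\<close>).
  Hence the event is a disjoint union, over the value \<open>m\<close> of \<open>Z\<^sub>n\<close>, of the events that the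
  set of hits up to time \<open>(q + 1) m\<close> has \<open>n\<close> elements, the last of which is \<open>m\<close> (lemma
  \<open>gap_ratio_iff\<close>). There are \<open>(m - 1) choose (n - 1)\<close> such sets, each attained with probability
  \<open>p ^ n (1 - p) ^ ((q + 1) m - n)\<close>, and the sum over \<open>m\<close> is a negative binomial series in \<open>s\<close>.
\<close>

section \<open>Hitting times as counting\<close>

definition hits :: "nat \<Rightarrow> (nat \<Rightarrow> nat) \<Rightarrow> nat \<Rightarrow> nat set" where
  "hits k w m = {l \<in> {1..m}. w l = k}"

lemma finite_hits [simp]: "finite (hits k w m)"
  by (simp add: hits_def)

lemma hits_mono: "m \<le> m' \<Longrightarrow> hits k w m \<subseteq> hits k w m'"
  by (auto simp: hits_def)

lemma hits_Suc: "hits k w (Suc m) = (if w (Suc m) = k then insert (Suc m) (hits k w m) else hits k w m)"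
  by (auto simp: hits_def le_Suc_eq)

lemma card_hits_Suc: "card (hits k w (Suc m)) = card (hits k w m) + (if w (Suc m) = k then 1 else 0)"
proof -
  have "Suc m \<notin> hits k w m" by (auto simp: hits_def)
  then show ?thesis by (simp add: hits_Suc)
qed

text \<open>
  The recursion of the counting function, in the form that mirrors the definition of
  \<^const>\<open>hit_time\<close>: the witness \<open>l\<close> is a hit after the \<open>n\<close>-th one.
\<close>

lemma Suc_le_card_hits_iff:
  "Suc n \<le> card (hits k w m) \<longleftrightarrow> (\<exists>l\<in>{1..m}. w l = k \<and> n \<le> card (hits k w (l - 1)))"
proof (induction m)
  case 0
  then show ?case by (simp add: hits_def)
next
  case (Suc m)
  have "(\<exists>l\<in>{1..Suc m}. w l = k \<and> n \<le> card (hits k w (l - 1))) \<longleftrightarrow>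
        Suc n \<le> card (hits k w m) \<or> (w (Suc m) = k \<and> n \<le> card (hits k w m))"
    by (simp add: Suc.IH atLeastAtMostSuc_conv) blast
  then show ?case
    by (auto simp: card_hits_Suc)
qed

text \<open>
  Hitting times and counts are inverse to each other in the sense of a Galois connection. This
  replaces the nested infima in \<^typ>\<open>enat\<close>, including the value \<open>\<infinity>\<close>, by finite
  counts in all that follows.
\<close>

lemma hit_time_le_iff: "hit_time k n w \<le> enat m \<longleftrightarrow> n \<le> card (hits k w m)"
proof (induction n arbitrary: m)
  case 0
  then show ?case by simp
next
  case (Suc n)
  let ?S = "{l. 1 \<le> l \<and> hit_time k n w < enat l \<and> w l = k}"
  have below: "hit_time k n w < enat l \<longleftrightarrow> n \<le> card (hits k w (l - 1))" if "1 \<le> l" for l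
  proof -
    have "hit_time k n w < enat l \<longleftrightarrow> hit_time k n w \<le> enat (l - 1)"
      using that by (cases "hit_time k n w") auto
    then show ?thesis by (simp add: Suc.IH)
  qed
  have "hit_time k (Suc n) w \<le> enat m \<longleftrightarrow> (\<exists>l\<in>?S. l \<le> m)"
  proof
    assume le: "hit_time k (Suc n) w \<le> enat m"
    have "enat ` ?S \<noteq> {}"
    proof
      assume "enat ` ?S = {}"
      then have "hit_time k (Suc n) w = \<infinity>"
        unfolding hit_time.simps by (simp only: Inf_empty top_enat_def)
      then show False using le by simp
    qed
    then have "Inf (enat ` ?S) \<in> enat ` ?S"
      by (rule wellorder_InfI[OF some_in_eq[THEN iffD2]])
    then show "\<exists>l\<in>?S. l \<le> m" using le by auto
  next
    assume "\<exists>l\<in>?S. l \<le> m"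
    then obtain l where l: "l \<in> ?S" "l \<le> m" by blast
    from l(1) have "hit_time k (Suc n) w \<le> enat l"
      unfolding hit_time.simps by (intro Inf_lower) blast
    also have "\<dots> \<le> enat m" using l by simp
    finally show "hit_time k (Suc n) w \<le> enat m" .
  qed
  also have "\<dots> \<longleftrightarrow> (\<exists>l\<in>{1..m}. w l = k \<and> n \<le> card (hits k w (l - 1)))"
    using below by auto
  finally show ?case by (simp only: Suc_le_card_hits_iff)
qed

text \<open>The possible sets of the first \<open>n\<close> hits, given that the last of them is at time \<open>m\<close>.\<close>

definition subsets_with_last :: "nat \<Rightarrow> nat \<Rightarrow> nat set set" where
  "subsets_with_last n m = {A. A \<subseteq> {1..m} \<and> m \<in> A \<and> card A = n}"

lemma hit_time_eq_iff:
  assumes "1 \<le> m" "1 \<le> n"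
  shows "hit_time k n w = enat m \<longleftrightarrow> hits k w m \<in> subsets_with_last n m"
proof -
  obtain m' where m: "m = Suc m'" using assms by (cases m) auto
  have "hit_time k n w = enat m \<longleftrightarrow> hit_time k n w \<le> enat m \<and> \<not> hit_time k n w \<le> enat m'"
    unfolding m by (cases "hit_time k n w") auto
  also have "\<dots> \<longleftrightarrow> card (hits k w m) = n \<and> w m = k"
    by (auto simp: hit_time_le_iff m card_hits_Suc)
  also have "\<dots> \<longleftrightarrow> hits k w m \<in> subsets_with_last n m"
    using assms by (auto simp: subsets_with_last_def hits_def)
  finally show ?thesis .
qed

text \<open>
  If \<open>Z\<^sub>n = m\<close> is finite, the ratio exceeds \<open>q\<close> iff \<open>Z\<^sub>n\<^sub>+\<^sub>1 > (q + 1) m\<close>, that is, iff no hit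
  occurs between \<open>m\<close> and \<open>(q + 1) m\<close>. If \<open>Z\<^sub>n = \<infinity>\<close>, both sides fail: the ratio is
  \<open>\<infinity> / \<infinity>\<close>, which is \<open>0\<close> in \<^typ>\<open>ereal\<close>, and there are fewer than \<open>n\<close> hits in all.
  Each event on the right depends on finitely many coordinates.
\<close>

lemma gap_ratio_iff:
  assumes n: "1 \<le> n"
  shows "ereal_of_enat (gap_time k (n + 1) w) / ereal_of_enat (hit_time k n w) > ereal (real q)
    \<longleftrightarrow> (\<exists>m. hits k w ((q + 1) * m) \<in> subsets_with_last n m)"
proof (cases "hit_time k n w")
  case (enat m)
  have pos: "1 \<le> m"
  proof (rule ccontr)
    assume "\<not> 1 \<le> m"
    then have "hit_time k n w \<le> enat 0" by (simp add: enat zero_enat_def)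
    then have "n \<le> card (hits k w 0)" by (simp only: hit_time_le_iff)
    then show False using n by (simp add: hits_def)
  qed
  have last: "hits k w m \<in> subsets_with_last n m"
    using enat hit_time_eq_iff[OF pos n] by simp
  have "ereal_of_enat (gap_time k (n + 1) w) / ereal_of_enat (hit_time k n w) > ereal (real q)
      \<longleftrightarrow> enat ((q + 1) * m) < hit_time k (n + 1) w"
  proof (cases "hit_time k (n + 1) w")
    case (enat l)
    have "ereal_of_enat (gap_time k (n + 1) w) / ereal_of_enat (hit_time k n w) > ereal (real q)
        \<longleftrightarrow> real q < real (l - m) / real m"
      using pos enat \<open>hit_time k n w = enat m\<close> by (simp add: gap_time_def)
    also have "\<dots> \<longleftrightarrow> real (q * m) < real (l - m)"
      using pos by (simp add: pos_less_divide_eq)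
    also have "\<dots> \<longleftrightarrow> q * m < l - m"
      by (rule of_nat_less_iff)
    also have "\<dots> \<longleftrightarrow> (q + 1) * m < l"
      by (auto simp: less_diff_conv)
    finally show ?thesis by (simp only: enat enat_ord_simps)
  next
    case infinity
    then show ?thesis using pos enat by (simp add: gap_time_def)
  qed
  also have "\<dots> \<longleftrightarrow> \<not> n + 1 \<le> card (hits k w ((q + 1) * m))"
    using hit_time_le_iff[of k "n + 1" w "(q + 1) * m"] by (simp add: not_le [symmetric])
  also have "\<dots> \<longleftrightarrow> hits k w ((q + 1) * m) = hits k w m"
  proof
    have sub: "hits k w m \<subseteq> hits k w ((q + 1) * m)" by (rule hits_mono) simp
    assume "\<not> n + 1 \<le> card (hits k w ((q + 1) * m))"
    then have "card (hits k w ((q + 1) * m)) \<le> card (hits k w m)"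
      using last by (simp add: subsets_with_last_def)
    then show "hits k w ((q + 1) * m) = hits k w m"
      using card_seteq[OF finite_hits sub] by simp
  qed (use last in \<open>simp add: subsets_with_last_def\<close>)
  also have "\<dots> \<longleftrightarrow> (\<exists>m. hits k w ((q + 1) * m) \<in> subsets_with_last n m)"
  proof
    assume "\<exists>m. hits k w ((q + 1) * m) \<in> subsets_with_last n m"
    then obtain m' where m': "hits k w ((q + 1) * m') \<in> subsets_with_last n m'" by blast
    have eq: "hits k w ((q + 1) * m') = hits k w m'"
      using m' by (auto simp: subsets_with_last_def hits_def)
    have "1 \<le> m'" using m' by (auto simp: subsets_with_last_def)
    then have "hit_time k n w = enat m'" using m' eq n by (simp add: hit_time_eq_iff)
    with enat eq show "hits k w ((q + 1) * m) = hits k w m" by simp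
  qed (use last in metis)
  finally show ?thesis .
next
  case infinity
  have "hits k w ((q + 1) * m) \<notin> subsets_with_last n m" for m
  proof
    assume "hits k w ((q + 1) * m) \<in> subsets_with_last n m"
    then have "hit_time k n w \<le> enat ((q + 1) * m)"
      unfolding hit_time_le_iff by (simp add: subsets_with_last_def)
    then show False using infinity by simp
  qed
  then show ?thesis by (simp add: infinity)
qed

text \<open>Removing the prescribed maximum leaves an arbitrary set of \<open>n - 1\<close> earlier times.\<close>

lemma card_subsets_with_last:
  assumes "1 \<le> n" "1 \<le> m"
  shows "card (subsets_with_last n m) = (m - 1) choose (n - 1)"
proof -
  have "bij_betw (insert m) {A. A \<subseteq> {1..m - 1} \<and> card A = n - 1} (subsets_with_last n m)"
  proof (rule bij_betwI[where g = "\<lambda>A. A - {m}"])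
    show "insert m \<in> {A. A \<subseteq> {1..m - 1} \<and> card A = n - 1} \<rightarrow> subsets_with_last n m"
    proof
      fix A assume A: "A \<in> {A. A \<subseteq> {1..m - 1} \<and> card A = n - 1}"
      then have "finite A" "m \<notin> A" using assms by (auto intro: finite_subset)
      then show "insert m A \<in> subsets_with_last n m"
        using A assms by (fastforce simp: subsets_with_last_def)
    qed
    show "(\<lambda>A. A - {m}) \<in> subsets_with_last n m \<rightarrow> {A. A \<subseteq> {1..m - 1} \<and> card A = n - 1}"
    proof
      fix A assume A: "A \<in> subsets_with_last n m"
      then have "A \<subseteq> {1..m}" by (simp add: subsets_with_last_def)
      then have "A - {m} \<subseteq> {1..m - 1}" by fastforce
      then show "A - {m} \<in> {A. A \<subseteq> {1..m - 1} \<and> card A = n - 1}"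
        using A by (simp add: subsets_with_last_def)
    qed
  qed (use assms in \<open>fastforce simp: subsets_with_last_def\<close>)+
  then have "card (subsets_with_last n m) = card {A. A \<subseteq> {1..m - 1} \<and> card A = n - 1}"
    by (metis bij_betw_same_card)
  then show ?thesis by (simp add: n_subsets)
qed

section \<open>The exact probability\<close>

text \<open>
  By independence: prescribing the set of hits up to time \<open>N\<close> imposes one condition on each of the
  coordinates \<open>1, \<dots>, N\<close>, to equal \<open>k\<close> or to differ from \<open>k\<close>.
\<close>

lemma
  assumes B: "bernoulli_process M r pv X" and k: "k \<in> {1..r}" and A: "A \<subseteq> {1..N}"
  shows sets_hits_eq: "{x \<in> space M. hits k (\<lambda>i. X i x) N = A} \<in> sets M" (is "?E \<in> _")
    and prob_hits_eq: "measure M {x \<in> space M. hits k (\<lambda>i. X i x) N = A}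
           = pv k ^ card A * (1 - pv k) ^ (N - card A)"
proof -
  interpret prob_space M using B by (simp add: bernoulli_process_def)
  have indep: "indep_vars (\<lambda>_. count_space {1..r}) X {1..}"
    and law: "\<And>i. 1 \<le> i \<Longrightarrow> prob {x \<in> space M. X i x = k} = pv k"
    using B k by (auto simp: bernoulli_process_def)
  have meas: "X i \<in> M \<rightarrow>\<^sub>M count_space {1..r}" if "1 \<le> i" for i
    using indep that by (auto simp: indep_vars_def)
  define T where "T i = (if i \<in> A then {k} else {1..r} - {k})" for i
  have T: "T i \<in> sets (count_space {1..r})" for i
    using k by (auto simp: T_def)
  have vim: "X i -` T i \<inter> space M
      = (if i \<in> A then {x \<in> space M. X i x = k} else space M - {x \<in> space M. X i x = k})"
    if "1 \<le> i" for i
    using measurable_space[OF meas[OF that]] by (auto simp: T_def)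
  have ev: "{x \<in> space M. X i x = k} \<in> events" if "1 \<le> i" for i
  proof -
    have "X i -` {k} \<inter> space M \<in> events"
      by (rule measurable_sets[OF meas[OF that]]) (use k in simp)
    moreover have "X i -` {k} \<inter> space M = {x \<in> space M. X i x = k}" by auto
    ultimately show ?thesis by simp
  qed
  have marginal: "prob (X i -` T i \<inter> space M) = (if i \<in> A then pv k else 1 - pv k)"
    if "1 \<le> i" for i
    using that by (simp add: vim law prob_compl ev)
  \<comment> \<open>The factor \<^term>\<open>space M\<close> makes this true for \<open>N = 0\<close>, where the intersection is \<^term>\<open>UNIV\<close>.\<close>
  have E: "?E = space M \<inter> (\<Inter>i\<in>{1..N}. X i -` T i \<inter> space M)"
  proof (intro set_eqI)
    fix x
    have "hits k (\<lambda>i. X i x) N = A \<longleftrightarrow> (\<forall>i\<in>{1..N}. X i x = k \<longleftrightarrow> i \<in> A)"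
      using A unfolding hits_def by blast
    moreover have "x \<in> X i -` T i \<inter> space M \<longleftrightarrow> (X i x = k \<longleftrightarrow> i \<in> A)"
      if "x \<in> space M" "i \<in> {1..N}" for i
      using that by (subst vim) auto
    ultimately show "x \<in> ?E \<longleftrightarrow> x \<in> space M \<inter> (\<Inter>i\<in>{1..N}. X i -` T i \<inter> space M)"
      by blast
  qed
  have "?E \<in> events \<and> prob ?E = (\<Prod>i\<in>{1..N}. prob (X i -` T i \<inter> space M))" if "N \<noteq> 0"
  proof -
    have "?E = (\<Inter>i\<in>{1..N}. X i -` T i \<inter> space M)"
      unfolding E using that by auto
    moreover have "(\<Inter>i\<in>{1..N}. X i -` T i \<inter> space M) \<in> events"
    proof (rule sets.finite_INT)
      show "X i -` T i \<inter> space M \<in> events" if "i \<in> {1..N}" for i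
        using that by (intro measurable_sets[OF meas T]) simp
    qed (use that in auto)
    moreover have "prob (\<Inter>i\<in>{1..N}. X i -` T i \<inter> space M) = (\<Prod>i\<in>{1..N}. prob (X i -` T i \<inter> space M))"
      using that T by (intro indep_varsD[OF indep]) auto
    ultimately show ?thesis by simp
  qed
  moreover have "?E = space M" if "N = 0"
    unfolding E using that by simp
  ultimately have main: "?E \<in> events" "prob ?E = (\<Prod>i\<in>{1..N}. prob (X i -` T i \<inter> space M))"
    by (cases "N = 0"; simp add: prob_space)+
  show "?E \<in> events" by (rule main)
  have "prob ?E = (\<Prod>i\<in>{1..N}. if i \<in> A then pv k else 1 - pv k)"
    unfolding main(2) by (rule prod.cong) (simp_all add: marginal)
  also have "\<dots> = (\<Prod>i\<in>A. pv k) * (\<Prod>i\<in>{1..N} - A. 1 - pv k)"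
    using A by (subst prod.subset_diff[OF A]) (auto intro!: arg_cong2[where f = "(*)"] prod.cong)
  also have "\<dots> = pv k ^ card A * (1 - pv k) ^ (N - card A)"
    using A by (simp add: card_Diff_subset finite_subset)
  finally show "prob ?E = pv k ^ card A * (1 - pv k) ^ (N - card A)" .
qed

lemma
  assumes B: "bernoulli_process M r pv X" and k: "k \<in> {1..r}" and n: "1 \<le> n" and m: "1 \<le> m"
  shows sets_hits_last: "{x \<in> space M. hits k (\<lambda>i. X i x) ((q + 1) * m) \<in> subsets_with_last n m} \<in> sets M"
    (is "?E \<in> _")
    and prob_hits_last: "measure M {x \<in> space M. hits k (\<lambda>i. X i x) ((q + 1) * m) \<in> subsets_with_last n m}
      = real ((m - 1) choose (n - 1)) * pv k ^ n * (1 - pv k) ^ ((q + 1) * m - n)"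
proof -
  interpret prob_space M using B by (simp add: bernoulli_process_def)
  let ?N = "(q + 1) * m"
  let ?F = "\<lambda>A. {x \<in> space M. hits k (\<lambda>i. X i x) ?N = A}"
  have sub: "A \<subseteq> {1..?N}" if "A \<in> subsets_with_last n m" for A
    using that by (force simp: subsets_with_last_def)
  have fin: "finite (subsets_with_last n m)"
    by (rule finite_subset[of _ "Pow {1..m}"]) (auto simp: subsets_with_last_def)
  have F: "?F ` subsets_with_last n m \<subseteq> events"
    using sets_hits_eq[OF B k sub] by blast
  have E: "?E = (\<Union>A\<in>subsets_with_last n m. ?F A)" by auto
  show "?E \<in> events"
    unfolding E using fin F by (intro sets.finite_UN) auto
  have "prob ?E = (\<Sum>A\<in>subsets_with_last n m. prob (?F A))"
    unfolding E by (rule finite_measure_finite_Union[OF fin F]) (auto simp: disjoint_family_on_def)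
  also have "\<dots> = (\<Sum>A\<in>subsets_with_last n m. pv k ^ n * (1 - pv k) ^ (?N - n))"
    using prob_hits_eq[OF B k sub] by (intro sum.cong) (auto simp: subsets_with_last_def)
  also have "\<dots> = real ((m - 1) choose (n - 1)) * pv k ^ n * (1 - pv k) ^ (?N - n)"
    using n m by (simp add: card_subsets_with_last)
  finally show "prob ?E = real ((m - 1) choose (n - 1)) * pv k ^ n * (1 - pv k) ^ (?N - n)" .
qed

text \<open>This series says that the negative binomial distribution with success probability \<open>1 - s\<close> has total mass \<open>1\<close>.\<close>

lemma negative_binomial_sums:
  fixes s :: real
  assumes "0 \<le> s" "s < 1"
  shows "(\<lambda>j. real ((j + n - 1) choose j) * s ^ j) sums (1 / (1 - s)) ^ n"
proof -
  have "pmf (neg_binomial_pmf n (1 - s)) sums 1"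
    using sums_integral_count_space_nat[OF integrable_pmf, of "neg_binomial_pmf n (1 - s)"]
    by (simp add: integral_pmf)
  also have "pmf (neg_binomial_pmf n (1 - s)) = (\<lambda>j. real ((j + n - 1) choose j) * (1 - s) ^ n * s ^ j)"
    using assms by (intro ext) (subst pmf_neg_binomial; simp)
  finally have "(\<lambda>j. real ((j + n - 1) choose j) * (1 - s) ^ n * s ^ j / (1 - s) ^ n) sums (1 / (1 - s) ^ n)"
    by (rule sums_divide)
  moreover have "real ((j + n - 1) choose j) * (1 - s) ^ n * s ^ j / (1 - s) ^ n
      = real ((j + n - 1) choose j) * s ^ j" for j
    using assms by simp
  ultimately show ?thesis by (simp only: power_one_over)
qed

lemma prob_gap_ratio:
  assumes B: "bernoulli_process M r pv X" and k: "k \<in> {1..r}" and n: "1 \<le> n"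
    and p: "p = pv k" "0 < p" "p < 1"
  shows "measure M {x \<in> space M.
              ereal_of_enat (gap_time k (n + 1) (\<lambda>i. X i x))
                / ereal_of_enat (hit_time k n (\<lambda>i. X i x)) > ereal (real q)}
         = (p * (1 - p) ^ q / (1 - (1 - p) ^ (q + 1))) ^ n"
proof -
  interpret prob_space M using B by (simp add: bernoulli_process_def)
  let ?N = "\<lambda>m. (q + 1) * m"
  let ?E = "\<lambda>m. {x \<in> space M. hits k (\<lambda>i. X i x) (?N m) \<in> subsets_with_last n m}"
  define s where "s = (1 - p) ^ (q + 1)"
  have s: "0 \<le> s" "s < 1" using p power_Suc_less_one[of "1 - p" q] by (simp_all add: s_def)
  have empty: "hits k w (?N m) \<notin> subsets_with_last n m" if "m < n" for m w
  proof
    assume "hits k w (?N m) \<in> subsets_with_last n m"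
    then have "n \<le> card {1..m}"
      unfolding subsets_with_last_def by (metis (mono_tags, lifting) card_mono finite_atLeastAtMost mem_Collect_eq)
    then show False using that by simp
  qed
  \<comment> \<open>Shifting the index by \<open>n\<close> drops only empty events and gives the sum the shape of the negative binomial series.\<close>
  have "{x \<in> space M.
              ereal_of_enat (gap_time k (n + 1) (\<lambda>i. X i x))
                / ereal_of_enat (hit_time k n (\<lambda>i. X i x)) > ereal (real q)}
      = (\<Union>j. ?E (j + n))"
  proof -
    have "(\<exists>m. hits k w (?N m) \<in> subsets_with_last n m)
        \<longleftrightarrow> (\<exists>j. hits k w (?N (j + n)) \<in> subsets_with_last n (j + n))" for w
      using empty by (metis le_add_diff_inverse2 not_le)
    then show ?thesis by (simp only: gap_ratio_iff[OF n]) blast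
  qed
  moreover have "(\<lambda>j. prob (?E (j + n))) sums prob (\<Union>j. ?E (j + n))"
  proof (rule finite_measure_UNION)
    show "range (\<lambda>j. ?E (j + n)) \<subseteq> events"
      using sets_hits_last[OF B k n] n by auto
    \<comment> \<open>For \<open>m < m'\<close> the two hit sets are nested and have \<open>n\<close> elements each, so they coincide; but one contains \<open>m'\<close> and the other is bounded by \<open>m\<close>.\<close>
    have False if "hits k w (?N m) \<in> subsets_with_last n m"
      "hits k w (?N m') \<in> subsets_with_last n m'" "m < m'" for m m' w
    proof -
      have "hits k w (?N m) \<subseteq> hits k w (?N m')"
        using \<open>m < m'\<close> by (intro hits_mono mult_le_mono) auto
      then have "hits k w (?N m) = hits k w (?N m')"
        using that by (intro card_subset_eq) (auto simp: subsets_with_last_def)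
      then have "m' \<in> hits k w (?N m)" using that by (simp add: subsets_with_last_def)
      then show False using that by (auto simp: subsets_with_last_def)
    qed
    then show "disjoint_family (\<lambda>j. ?E (j + n))"
      unfolding disjoint_family_on_def
      by (auto simp only: disjoint_iff mem_Collect_eq) (metis add_right_cancel linorder_neqE_nat)
  qed
  moreover have "prob (?E (j + n))
      = (p * (1 - p) ^ q) ^ n * (real ((j + n - 1) choose j) * s ^ j)" for j
  proof -
    have "(j + n - 1) choose (n - 1) = (j + n - 1) choose j"
      using n by (subst binomial_symmetric) auto
    moreover have "?N (j + n) - n = q * n + (q + 1) * j" by (simp add: algebra_simps)
    ultimately show ?thesis
      using prob_hits_last[OF B k n, of "j + n" q] n
      by (simp add: p(1)[symmetric] s_def power_add power_mult power_mult_distrib)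
  qed
  moreover have "(\<lambda>j. (p * (1 - p) ^ q) ^ n * (real ((j + n - 1) choose j) * s ^ j))
      sums ((p * (1 - p) ^ q) ^ n * (1 / (1 - s)) ^ n)"
    by (intro sums_mult negative_binomial_sums s)
  ultimately have "measure M {x \<in> space M.
              ereal_of_enat (gap_time k (n + 1) (\<lambda>i. X i x))
                / ereal_of_enat (hit_time k n (\<lambda>i. X i x)) > ereal (real q)}
      = (p * (1 - p) ^ q) ^ n * (1 / (1 - s)) ^ n"
    by (simp only: sums_unique2)
  then show ?thesis by (simp add: s_def power_mult_distrib power_divide)
qed

section \<open>The growth rate in closed form\<close>

text \<open>
  From \<open>C = s (C + 1)\<close> one gets \<open>(C + 1) powr C / C powr C = s powr (- C)\<close>, which cancels the factor
  \<open>(1 - p) powr ((1 + q) C) = s powr C\<close>; what remains is \<open>(C + 1) p (1 - p) ^ q\<close>.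
\<close>

lemma rate_eq:
  fixes p C :: real
  assumes p: "0 < p" "p < 1" and C: "C = C_const p q"
  shows "(C + 1) powr (C + 1) / C powr C * p * (1 - p) powr ((1 + real q) * C + real q)
    = p * (1 - p) ^ q / (1 - (1 - p) ^ (q + 1))"
proof -
  define s where "s = (1 - p) ^ (q + 1)"
  have s: "0 < s" "s < 1" using p power_Suc_less_one[of "1 - p" q] by (simp_all add: s_def)
  have s_powr: "s = (1 - p) powr (1 + real q)"
    using p by (simp add: s_def powr_add powr_realpow)
  have inv_s: "(1 - p) powr (- real q - 1) = inverse s"
  proof -
    have "- real q - 1 = - (1 + real q)" by simp
    then show ?thesis by (simp only: s_powr powr_minus)
  qed
  have "C = inverse (inverse s - 1)"
    by (simp only: C C_const_def inv_s)
  then have C_s: "C = s / (1 - s)"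
    using s by (simp add: field_simps)
  then have Cpos: "0 < C" using s by simp
  have C1: "C + 1 = 1 / (1 - s)"
    using C_s s by (simp add: field_simps)
  have "C = s * (C + 1)" using C1 C_s by simp
  then have "C powr C = s powr C * (C + 1) powr C"
    using Cpos s by (metis less_eq_real_def powr_mult add_pos_pos zero_less_one)
  moreover have "(1 - p) powr ((1 + real q) * C + real q) = s powr C * (1 - p) ^ q"
  proof -
    have "(1 - p) powr ((1 + real q) * C) = s powr C"
      by (simp only: s_powr powr_powr)
    then show ?thesis
      using p powr_add[of "1 - p" "(1 + real q) * C" "real q"] by (simp add: powr_realpow)
  qed
  ultimately have "(C + 1) powr (C + 1) / C powr C * p * (1 - p) powr ((1 + real q) * C + real q)
      = (C + 1) * (p * (1 - p) ^ q)"
    using Cpos s by (simp add: powr_add)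
  then show ?thesis by (simp add: C1 s_def)
qed

theorem mainTheorem2:
  fixes M :: "'a measure" and r k q :: nat and pv :: "nat \<Rightarrow> real"
    and X :: "nat \<Rightarrow> 'a \<Rightarrow> nat" and p C :: real
  assumes "bernoulli_process M r pv X"
    and "k \<in> {1..r}"
    and "p = pv k" and "0 < p" and "p < 1"
    and "1 \<le> q"
    and "C = C_const p q"
  shows "(\<lambda>n. measure M {x \<in> space M.
              ereal_of_enat (gap_time k (n + 1) (\<lambda>i. X i x))
                / ereal_of_enat (hit_time k n (\<lambda>i. X i x)) > ereal (real q)})
         \<sim>[at_top]
         (\<lambda>n. ((C + 1) powr (C + 1) / C powr C * p
                 * (1 - p) powr ((1 + real q) * C + real q)) ^ n)"
proof (rule asymp_equiv_refl_ev, rule eventually_mono[OF eventually_ge_at_top[of 1]])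
  fix n :: nat
  assume "1 \<le> n"
  then show "measure M {x \<in> space M.
              ereal_of_enat (gap_time k (n + 1) (\<lambda>i. X i x))
                / ereal_of_enat (hit_time k n (\<lambda>i. X i x)) > ereal (real q)}
      = ((C + 1) powr (C + 1) / C powr C * p
                 * (1 - p) powr ((1 + real q) * C + real q)) ^ n"
    using assms prob_gap_ratio[of M r pv X k n p q] rate_eq[of p C q] by simp
qed

end
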